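(* Let $G$ be a finite graph with vertex set $V$, let $\beta\ge0$, and let $h$ be at least the maximum degree of $G$. For any $S\subseteq V$, let $\tilde X_t^S$ be the $S$-corrupted Glauber dynamics on $G$ with inverse temperature $\beta$ and external field $h$ (with the spins on $S$ fixed to $+1$), started from a common initial configuration. Then $$S\mapsto \mathbb{E}\left[\,\big|\{v\in V:\tilde X_t^S(v)=+1\}\big|\,\right]$$ is a submodular function of $S$ for every $t\ge0$.
   Context: Configurations are $\sigma\in\{+1,-1\}^{V}$. Glauber dynamics with inverse temperature $\beta$ and external field $h$: at each step a vertex $v\in V$ is chosen uniformly at random and its spin is resampled, all other spins being unchanged; if $P\subseteq N(v)$ is the set of neighbours of $v$ with spin $+1$ and $d_v=|N(v)|$, the new spin is $+1$ with probability $$\frac{\exp(\beta(2|P|-d_v+h))}{\exp(\beta(2|P|-d_v+h))+\exp(\beta(-2|P|+d_v-h))}$$ and $-1$ otherwise. In the $S$-corrupted dynamics the vertices of $S$ are held at spin $+1$ at all times and all other vertices are updated as in the standard dynamics; for different $S$ the initial configurations agree with a common configuration outside $S$. A set function $f:2^V\to\mathbb{R}$ is submodular if $f(S)+f(T)\ge f(S\cup T)+f(S\cap T)$ for all $S,T\subseteq V$. *)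

theory Defs
  imports
    "HOL-Probability.Probability"
    "HOL-Library.FuncSet"
    "Graph_Theory.Pair_Digraph"
begin

text \<open>
  Finite simple undirected graphs are rendered by the locale predicate \<open>pair_graph\<close> (finite vertex
  set, symmetric loop-free arc relation): the edge \<open>{u, v}\<close> is the pair of arcs \<open>(u, v)\<close>, \<open>(v, u)\<close>.
\<close>

definition neighbours :: "'a pair_pre_digraph \<Rightarrow> 'a \<Rightarrow> 'a set" where
  "neighbours G v = {u \<in> pverts G. (v, u) \<in> parcs G}"

definition degree :: "'a pair_pre_digraph \<Rightarrow> 'a \<Rightarrow> nat" where
  "degree G v = card (neighbours G v)"

definition max_degree :: "'a pair_pre_digraph \<Rightarrow> nat" where
  "max_degree G = Max (degree G ` pverts G)"

type_synonym 'a config = "'a \<Rightarrow> int"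

definition configs :: "'a set \<Rightarrow> 'a config set" where
  "configs V = V \<rightarrow>\<^sub>E {1, -1}"

definition plus_neighbours :: "'a pair_pre_digraph \<Rightarrow> 'a config \<Rightarrow> 'a \<Rightarrow> 'a set" where
  "plus_neighbours G \<sigma> v = {u \<in> neighbours G v. \<sigma> u = 1}"

definition plus_prob :: "'a pair_pre_digraph \<Rightarrow> real \<Rightarrow> real \<Rightarrow> 'a config \<Rightarrow> 'a \<Rightarrow> real" where
  "plus_prob G \<beta> h \<sigma> v =
    (let p = real (card (plus_neighbours G \<sigma> v)); d = real (degree G v)
     in exp (\<beta> * (2 * p - d + h)) / (exp (\<beta> * (2 * p - d + h)) + exp (\<beta> * (- 2 * p + d - h))))"

definition resample ::
    "'a pair_pre_digraph \<Rightarrow> real \<Rightarrow> real \<Rightarrow> 'a \<Rightarrow> 'a config \<Rightarrow> 'a config pmf" where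
  "resample G \<beta> h v \<sigma> =
    map_pmf (\<lambda>b. \<sigma>(v := (if b then 1 else -1))) (bernoulli_pmf (plus_prob G \<beta> h \<sigma> v))"

text \<open>
  The updated vertex is drawn from all of \<open>V\<close>, including \<open>S\<close>; choosing a vertex of \<open>S\<close> leaves the
  configuration unchanged.  For \<open>S = {}\<close> this is the standard Glauber dynamics.
\<close>

definition corrupted_step ::
    "'a pair_pre_digraph \<Rightarrow> real \<Rightarrow> real \<Rightarrow> 'a set \<Rightarrow> 'a config \<Rightarrow> 'a config pmf" where
  "corrupted_step G \<beta> h S \<sigma> =
    bind_pmf (pmf_of_set (pverts G))
      (\<lambda>v. if v \<in> S then return_pmf \<sigma> else resample G \<beta> h v \<sigma>)"

definition corrupt :: "'a set \<Rightarrow> 'a config \<Rightarrow> 'a config" where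
  "corrupt S \<sigma> = (\<lambda>v. if v \<in> S then 1 else \<sigma> v)"

text \<open>The law of the \<open>S\<close>-corrupted dynamics after \<open>t\<close> steps, started from \<open>\<sigma>\<^sub>0\<close> outside \<open>S\<close>.\<close>

primrec corrupted_glauber ::
    "'a pair_pre_digraph \<Rightarrow> real \<Rightarrow> real \<Rightarrow> 'a set \<Rightarrow> 'a config \<Rightarrow> nat \<Rightarrow> 'a config pmf" where
  "corrupted_glauber G \<beta> h S \<sigma>\<^sub>0 0 = return_pmf (corrupt S \<sigma>\<^sub>0)"
| "corrupted_glauber G \<beta> h S \<sigma>\<^sub>0 (Suc t) =
    bind_pmf (corrupted_glauber G \<beta> h S \<sigma>\<^sub>0 t) (corrupted_step G \<beta> h S)"

definition submodular_on :: "'a set \<Rightarrow> ('a set \<Rightarrow> real) \<Rightarrow> bool" where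
  "submodular_on V f \<longleftrightarrow>
    (\<forall>S T. S \<subseteq> V \<longrightarrow> T \<subseteq> V \<longrightarrow> f S + f T \<ge> f (S \<union> T) + f (S \<inter> T))"

end

theory Submission
  imports Defs
begin

text \<open>
  Run the dynamics for \<open>S \<inter> T\<close>, \<open>S\<close>, \<open>T\<close> and \<open>S \<union> T\<close> together on one probability space, so that the
  plus sets \<open>A, B, C, D\<close> always satisfy \<open>A \<subseteq> B \<inter> C\<close> and \<open>D \<subseteq> B \<union> C\<close>; then
  \<open>|A| + |D| \<le> |B| + |C|\<close> pointwise, and taking expectations gives the claim.  Four coins with success
  probabilities \<open>p\<^sub>A, p\<^sub>B, p\<^sub>C, p\<^sub>D\<close> can be coupled so that \<open>a \<longrightarrow> b \<and> c\<close> and \<open>d \<longrightarrow> b \<or> c\<close> as soon as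
  \<open>p\<^sub>A \<le> p\<^sub>B, p\<^sub>C\<close> and \<open>p\<^sub>A + p\<^sub>D \<le> p\<^sub>B + p\<^sub>C\<close>.  The resampling probability is a logistic function of
  the local field, which is nonnegative since \<open>h\<close> dominates the degrees; on that half line the logistic
  function is increasing and concave, which yields these inequalities.
\<close>

section \<open>Couplings of four distributions\<close>

text \<open>The analogue of \<open>rel_pmf\<close> for four marginals; the joint law
  \<open>J\<close> plays the role of the common probability space.\<close>

definition rel_pmf4 ::
    "('b \<Rightarrow> 'b \<Rightarrow> 'b \<Rightarrow> 'b \<Rightarrow> bool) \<Rightarrow> 'b pmf \<Rightarrow> 'b pmf \<Rightarrow> 'b pmf \<Rightarrow> 'b pmf \<Rightarrow> bool" where
  "rel_pmf4 R A B C D \<longleftrightarrow> (\<exists>J :: ('b \<times> 'b \<times> 'b \<times> 'b) pmf.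
     map_pmf (\<lambda>(a, b, c, d). a) J = A \<and> map_pmf (\<lambda>(a, b, c, d). b) J = B \<and>
     map_pmf (\<lambda>(a, b, c, d). c) J = C \<and> map_pmf (\<lambda>(a, b, c, d). d) J = D \<and>
     (\<forall>(a, b, c, d) \<in> set_pmf J. R a b c d))"

lemma rel_pmf4_return: "R a b c d \<Longrightarrow>
    rel_pmf4 R (return_pmf a) (return_pmf b) (return_pmf c) (return_pmf d)"
  unfolding rel_pmf4_def by (rule exI[of _ "return_pmf (a, b, c, d)"]) simp

lemma rel_pmf4_diagonal: "(\<And>x. x \<in> set_pmf P \<Longrightarrow> R x x x x) \<Longrightarrow> rel_pmf4 R P P P P"
  unfolding rel_pmf4_def
  by (rule exI[of _ "map_pmf (\<lambda>x. (x, x, x, x)) P"]) (auto simp: pmf.map_comp o_def)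

text \<open>Any coupling lives on the product of the supports. This later ensures that a coin of
  success probability 1, which marks a held vertex, comes up \<open>True\<close>.\<close>

lemma rel_pmf4_support:
  assumes "rel_pmf4 R A B C D"
  shows "rel_pmf4 (\<lambda>a b c d. R a b c d \<and> a \<in> set_pmf A \<and> b \<in> set_pmf B \<and> c \<in> set_pmf C \<and> d \<in> set_pmf D)
    A B C D"
proof -
  from assms obtain J where J:
    "map_pmf (\<lambda>(a, b, c, d). a) J = A" "map_pmf (\<lambda>(a, b, c, d). b) J = B"
    "map_pmf (\<lambda>(a, b, c, d). c) J = C" "map_pmf (\<lambda>(a, b, c, d). d) J = D"
    and R: "\<forall>(a, b, c, d) \<in> set_pmf J. R a b c d"
    unfolding rel_pmf4_def by blast
  show ?thesis
    unfolding rel_pmf4_def by (rule exI[of _ J]) (use R in \<open>force simp flip: J\<close>)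
qed

text \<open>Couplings compose: a conditional coupling \<open>K x\<close> is chosen for each
  \<open>x\<close> in the support of \<open>J\<close>, and \<open>bind_pmf J K\<close> glues them.
  This carries the one-step coupling to all times.\<close>

lemma rel_pmf4_bind:
  assumes "rel_pmf4 R A B C D"
    and "\<And>a b c d. R a b c d \<Longrightarrow> rel_pmf4 R' (f a) (g b) (h c) (k d)"
  shows "rel_pmf4 R' (bind_pmf A f) (bind_pmf B g) (bind_pmf C h) (bind_pmf D k)"
proof -
  from assms(1) obtain J where J:
    "A = map_pmf (\<lambda>(a, b, c, d). a) J" "B = map_pmf (\<lambda>(a, b, c, d). b) J"
    "C = map_pmf (\<lambda>(a, b, c, d). c) J" "D = map_pmf (\<lambda>(a, b, c, d). d) J"
    and R: "\<And>a b c d. (a, b, c, d) \<in> set_pmf J \<Longrightarrow> R a b c d"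
    unfolding rel_pmf4_def by blast
  have "\<forall>x \<in> set_pmf J. \<exists>K.
     map_pmf (\<lambda>(a, b, c, d). a) K = (case x of (a, b, c, d) \<Rightarrow> f a) \<and>
     map_pmf (\<lambda>(a, b, c, d). b) K = (case x of (a, b, c, d) \<Rightarrow> g b) \<and>
     map_pmf (\<lambda>(a, b, c, d). c) K = (case x of (a, b, c, d) \<Rightarrow> h c) \<and>
     map_pmf (\<lambda>(a, b, c, d). d) K = (case x of (a, b, c, d) \<Rightarrow> k d) \<and>
     (\<forall>(a, b, c, d) \<in> set_pmf K. R' a b c d)"
    using assms(2)[OF R] unfolding rel_pmf4_def by fastforce
  from bchoice[OF this] obtain K where K: "\<forall>x \<in> set_pmf J.
     map_pmf (\<lambda>(a, b, c, d). a) (K x) = (case x of (a, b, c, d) \<Rightarrow> f a) \<and>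
     map_pmf (\<lambda>(a, b, c, d). b) (K x) = (case x of (a, b, c, d) \<Rightarrow> g b) \<and>
     map_pmf (\<lambda>(a, b, c, d). c) (K x) = (case x of (a, b, c, d) \<Rightarrow> h c) \<and>
     map_pmf (\<lambda>(a, b, c, d). d) (K x) = (case x of (a, b, c, d) \<Rightarrow> k d) \<and>
     (\<forall>(a, b, c, d) \<in> set_pmf (K x). R' a b c d)"
    by blast
  show ?thesis
    unfolding rel_pmf4_def J
    by (rule exI[of _ "bind_pmf J K"])
      (use K in \<open>fastforce simp: map_bind_pmf bind_map_pmf split_beta intro!: bind_pmf_cong\<close>)
qed

lemma rel_pmf4_map:
  assumes "rel_pmf4 R A B C D"
    and "\<And>a b c d. R a b c d \<Longrightarrow> R' (f a) (g b) (h c) (k d)"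
  shows "rel_pmf4 R' (map_pmf f A) (map_pmf g B) (map_pmf h C) (map_pmf k D)"
  unfolding map_pmf_def by (rule rel_pmf4_bind[OF assms(1)]) (intro rel_pmf4_return assms(2))

text \<open>All four expectations become integrals over \<open>J\<close>, where the inequality holds
  pointwise; boundedness supplies integrability.\<close>

lemma rel_pmf4_expectation_mono:
  fixes f :: "'b \<Rightarrow> real"
  assumes "rel_pmf4 R A B C D"
    and mono: "\<And>a b c d. R a b c d \<Longrightarrow> f a + f d \<le> f b + f c"
    and bound: "\<And>x. norm (f x) \<le> M"
  shows "measure_pmf.expectation A f + measure_pmf.expectation D f
    \<le> measure_pmf.expectation B f + measure_pmf.expectation C f"
proof -
  from assms(1) obtain J where J:
    "A = map_pmf (\<lambda>(a, b, c, d). a) J" "B = map_pmf (\<lambda>(a, b, c, d). b) J"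
    "C = map_pmf (\<lambda>(a, b, c, d). c) J" "D = map_pmf (\<lambda>(a, b, c, d). d) J"
    and R: "\<And>a b c d. (a, b, c, d) \<in> set_pmf J \<Longrightarrow> R a b c d"
    unfolding rel_pmf4_def by blast
  have int: "integrable (measure_pmf J) (\<lambda>x. f (g x))" for g
    by (rule measure_pmf.integrable_const_bound[where B = M]) (use bound in auto)
  have "measure_pmf.expectation J
        (\<lambda>x. f (case x of (a, b, c, d) \<Rightarrow> a) + f (case x of (a, b, c, d) \<Rightarrow> d))
      \<le> measure_pmf.expectation J
        (\<lambda>x. f (case x of (a, b, c, d) \<Rightarrow> b) + f (case x of (a, b, c, d) \<Rightarrow> c))"
    by (intro integral_mono_AE Bochner_Integration.integrable_add int)
      (auto simp: AE_measure_pmf_iff intro!: mono dest!: R)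
  then show ?thesis
    unfolding J integral_map_pmf Bochner_Integration.integral_add[OF int int] .
qed

section \<open>Coupling of four coins\<close>

lemma bernoulli_pmf_one: "bernoulli_pmf 1 = return_pmf True"
  by (rule pmf_eqI) (auto simp: indicator_def split: bool.split)

lemma pmf_bool_eqI: "pmf p True = pmf q True \<Longrightarrow> p = (q :: bool pmf)"
  by (rule pmf_eqI) (metis (full_types) pmf_False_conv_True)

text \<open>The pair \<open>b\<close>, \<open>c\<close> is drawn first, overlapping with probability
  \<open>m\<close>; then \<open>a\<close> arises by thinning the event \<open>b \<and> c\<close> and
  \<open>d\<close> by thinning \<open>b \<or> c\<close>, so both implications hold by
  construction.\<close>

lemma rel_pmf4_bernoulli:
  fixes p q r s :: real
  assumes "0 \<le> p" "p \<le> q" "p \<le> r" "q \<le> 1" "r \<le> 1" "0 \<le> s" "s \<le> 1" "p + s \<le> q + r"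
  shows "rel_pmf4 (\<lambda>a b c d. (a \<longrightarrow> b \<and> c) \<and> (d \<longrightarrow> b \<or> c))
    (bernoulli_pmf p) (bernoulli_pmf q) (bernoulli_pmf r) (bernoulli_pmf s)"
proof -
  \<comment> \<open>The smallest possible probability of \<open>b \<and> c\<close> given that \<open>a\<close> implies it; it makes
    \<open>b \<or> c\<close> as likely as possible.\<close>
  define m where "m = max p (q + r - 1)"
  \<comment> \<open>The last bound is \<open>p + s \<le> q + r\<close> if \<open>m = p\<close>, and
    \<open>s \<le> 1\<close> if \<open>m = q + r - 1\<close>.\<close>
  have m: "p \<le> m" "m \<le> q" "m \<le> r" "q + r - 1 \<le> m" "0 \<le> m" "s \<le> q + r - m"
    using assms by (auto simp: m_def)
  \<comment> \<open>\<open>C b\<close> is the law of \<open>c\<close> given \<open>b\<close>. The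
    ratios in \<open>A\<close> and \<open>D\<close> scale the probabilities \<open>m\<close> of
    \<open>b \<and> c\<close> and \<open>q + r - m\<close> of \<open>b \<or> c\<close> down to
    \<open>p\<close> and \<open>s\<close>.\<close>
  define A where "A b c = (if b \<and> c then bernoulli_pmf (p / m) else return_pmf False)" for b c
  define C where "C b = (if b then bernoulli_pmf (m / q) else bernoulli_pmf ((r - m) / (1 - q)))" for b
  define D where "D b c = (if b \<or> c then bernoulli_pmf (s / (q + r - m)) else return_pmf False)" for b c
  define J where "J = do { b \<leftarrow> bernoulli_pmf q; c \<leftarrow> C b; a \<leftarrow> A b c; d \<leftarrow> D b c;
    return_pmf (a, b, c, d) }"
  have frac: "0 \<le> p / m" "p / m \<le> 1" "0 \<le> m / q" "m / q \<le> 1"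
    "0 \<le> (r - m) / (1 - q)" "(r - m) / (1 - q) \<le> 1"
    "0 \<le> s / (q + r - m)" "s / (q + r - m) \<le> 1"
    using m assms by (auto simp: divide_le_eq_1)
  \<comment> \<open>If a denominator vanishes, the bounds on \<open>m\<close> force its numerator to
    vanish too, so cancellation survives division by zero.\<close>
  have canc: "q * (m / q) = m" "(1 - q) * ((r - m) / (1 - q)) = r - m" "m * (p / m) = p"
    "(q + r - m) * (s / (q + r - m)) = s"
    using m assms by auto
  have q: "0 \<le> q" using assms by simp
  have True_bind: "pmf (bind_pmf (bernoulli_pmf x) f) True =
      x * pmf (f True) True + (1 - x) * pmf (f False) True" if "0 \<le> x" "x \<le> 1" for x and f :: "bool \<Rightarrow> bool pmf"
    using that by (simp add: pmf_bind)
  have "map_pmf (\<lambda>(a, b, c, d). a) J = bind_pmf (bernoulli_pmf q) (\<lambda>b. bind_pmf (C b) (\<lambda>c. A b c))"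
    by (simp add: J_def map_bind_pmf bind_return_pmf')
  also have "\<dots> = bernoulli_pmf p"
  proof (rule pmf_bool_eqI)
    have "pmf (bind_pmf (bernoulli_pmf q) (\<lambda>b. bind_pmf (C b) (\<lambda>c. A b c))) True
        = q * (m / q) * (p / m)"
      using q assms(4) frac by (simp add: True_bind A_def C_def bind_return_pmf')
    then show "pmf (bind_pmf (bernoulli_pmf q) (\<lambda>b. bind_pmf (C b) (\<lambda>c. A b c))) True
        = pmf (bernoulli_pmf p) True"
      using canc assms by simp
  qed
  finally have mA: "map_pmf (\<lambda>(a, b, c, d). a) J = bernoulli_pmf p" .
  have mB: "map_pmf (\<lambda>(a, b, c, d). b) J = bernoulli_pmf q"
    by (simp add: J_def map_bind_pmf bind_return_pmf')
  have "map_pmf (\<lambda>(a, b, c, d). c) J = bind_pmf (bernoulli_pmf q) C"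
    by (simp add: J_def map_bind_pmf bind_return_pmf')
  also have "\<dots> = bernoulli_pmf r"
  proof (rule pmf_bool_eqI)
    have "pmf (bind_pmf (bernoulli_pmf q) C) True
        = q * (m / q) + (1 - q) * ((r - m) / (1 - q))"
      using q assms(4) frac by (simp add: True_bind C_def)
    then show "pmf (bind_pmf (bernoulli_pmf q) C) True = pmf (bernoulli_pmf r) True"
      unfolding canc using assms by simp
  qed
  finally have mC: "map_pmf (\<lambda>(a, b, c, d). c) J = bernoulli_pmf r" .
  have "map_pmf (\<lambda>(a, b, c, d). d) J = bind_pmf (bernoulli_pmf q) (\<lambda>b. bind_pmf (C b) (\<lambda>c. D b c))"
    by (simp add: J_def map_bind_pmf bind_return_pmf')
  also have "\<dots> = bernoulli_pmf s"
  proof (rule pmf_bool_eqI)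
    let ?w = "s / (q + r - m)"
    have "pmf (bind_pmf (bernoulli_pmf q) (\<lambda>b. bind_pmf (C b) (\<lambda>c. D b c))) True
        = q * ?w + (1 - q) * ((r - m) / (1 - q)) * ?w"
      using q assms(4) frac by (simp add: True_bind D_def C_def bind_return_pmf')
    also have "\<dots> = (q + r - m) * ?w"
      unfolding canc(2) by algebra
    finally show "pmf (bind_pmf (bernoulli_pmf q) (\<lambda>b. bind_pmf (C b) (\<lambda>c. D b c))) True
        = pmf (bernoulli_pmf s) True"
      using canc(4) assms by simp
  qed
  finally have mD: "map_pmf (\<lambda>(a, b, c, d). d) J = bernoulli_pmf s" .
  have "(a \<longrightarrow> b \<and> c) \<and> (d \<longrightarrow> b \<or> c)" if "(a, b, c, d) \<in> set_pmf J" for a b c d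
    using that by (auto simp: J_def A_def D_def split: if_splits)
  with mA mB mC mD show ?thesis
    unfolding rel_pmf4_def by blast
qed

section \<open>The logistic function and the resampling probability\<close>

text \<open>With \<open>x\<close> only in the denominator, monotonicity and concavity become
  statements about reciprocals.\<close>

definition logistic :: "real \<Rightarrow> real" where
  "logistic x = 1 - 1 / (1 + exp x)"

lemma logistic_bounds: "0 \<le> logistic x" "logistic x \<le> 1"
  by (simp_all add: logistic_def field_simps add_pos_pos)

lemma logistic_mono: "x \<le> y \<Longrightarrow> logistic x \<le> logistic y"
  by (simp add: logistic_def frac_le add_pos_pos)

text \<open>Concavity in four-point form, proved without derivatives: after exponentiating, both
  pairs have the same product and the outer pair has the larger sum.\<close>

lemma logistic_concave:
  assumes "0 \<le> x" "x \<le> y" "x \<le> z" "x + w = y + z"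
  shows "logistic x + logistic w \<le> logistic y + logistic z"
proof -
  define P Q R U where E: "P = exp x" "Q = exp y" "R = exp z" "U = exp w"
  have ge: "1 \<le> P" "P \<le> Q" "P \<le> R" and pos: "0 < P" "0 < Q" "0 < R" "0 < U"
    using assms by (auto simp: E)
  have prod: "P * U = Q * R"
    using assms(4) by (simp add: E flip: exp_add)
  have "0 \<le> (Q - P) * (R - P)"
    using ge by simp
  also have "\<dots> = P * (U + P - Q - R)"
    using prod by (simp add: algebra_simps)
  finally have sum: "Q + R \<le> P + U"
    using pos by (simp add: zero_le_mult_iff)
  have "1 \<le> Q * R"
    using mult_mono[of 1 Q 1 R] ge by simp
  \<comment> \<open>The map \<open>t \<mapsto> (2 + t) / (1 + t + k)\<close> is increasing for \<open>k \<ge> 1\<close>; here \<open>k = QR = PU\<close>.\<close>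
  then have "0 \<le> (P + U - (Q + R)) * (Q * R - 1)"
    using sum by simp
  then have "(2 + (Q + R)) * (1 + (P + U) + Q * R) \<le> (2 + (P + U)) * (1 + (Q + R) + Q * R)"
    by (simp add: algebra_simps)
  then have "(2 + (Q + R)) / (1 + (Q + R) + Q * R) \<le> (2 + (P + U)) / (1 + (P + U) + Q * R)"
    using pos by (subst pos_le_divide_eq) (simp_all add: add_pos_pos pos_divide_le_eq mult.commute)
  moreover have "1 / (1 + Q) + 1 / (1 + R) = (2 + (Q + R)) / (1 + (Q + R) + Q * R)"
    using pos by (simp add: add_frac_eq algebra_simps)
  moreover have "1 / (1 + P) + 1 / (1 + U) = (2 + (P + U)) / (1 + (P + U) + P * U)"
    using pos by (simp add: add_frac_eq algebra_simps)
  ultimately show ?thesis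
    unfolding logistic_def E[symmetric] prod by linarith
qed

text \<open>The two exponents are opposite, so expanding the fraction by its numerator gives the
  logistic function at twice the exponent.\<close>

lemma plus_prob_logistic:
  "plus_prob G \<beta> h \<sigma> v =
    logistic (2 * \<beta> * (2 * real (card (plus_neighbours G \<sigma> v)) - real (degree G v) + h))"
proof -
  have "exp y / (exp y + exp (- y)) = logistic (2 * y)" for y :: real
  proof -
    have "exp y * exp y = exp (2 * y)" "exp y * exp (- y) = 1"
      by (simp_all flip: exp_add)
    then have "exp y / (exp y + exp (- y)) = exp (2 * y) / (exp (2 * y) + 1)"
      by (metis distrib_left exp_not_eq_zero mult_divide_mult_cancel_left)
    also have "\<dots> = logistic (2 * y)"
      using add_pos_pos[OF exp_gt_zero[of "2 * y"] zero_less_one] by (simp add: logistic_def divide_simps)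
    finally show ?thesis .
  qed
  from this[of "\<beta> * (2 * real (card (plus_neighbours G \<sigma> v)) - real (degree G v) + h)"]
  show ?thesis
    unfolding plus_prob_def Let_def by (simp add: algebra_simps)
qed

lemma plus_prob_bounds: "0 \<le> plus_prob G \<beta> h \<sigma> v" "plus_prob G \<beta> h \<sigma> v \<le> 1"
  unfolding plus_prob_logistic by (rule logistic_bounds)+

section \<open>Resampling probabilities of dominated configurations\<close>

definition plus_dominated :: "'a set \<Rightarrow> 'a config \<Rightarrow> 'a config \<Rightarrow> 'a config \<Rightarrow> 'a config \<Rightarrow> bool" where
  "plus_dominated V A B C D \<longleftrightarrow>
    (\<forall>v\<in>V. (A v = 1 \<longrightarrow> B v = 1 \<and> C v = 1) \<and> (D v = 1 \<longrightarrow> B v = 1 \<or> C v = 1))"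

text \<open>Applied with \<open>N\<close> a neighbourhood to compare probabilities, and with
  \<open>N = V\<close> for the final count.\<close>

lemma plus_dominated_card:
  assumes "plus_dominated V A B C D" "finite V" "N \<subseteq> V"
  defines "P \<equiv> \<lambda>\<sigma> :: 'a config. {u \<in> N. \<sigma> u = 1}"
  shows "card (P A) \<le> card (P B \<inter> P C)" "card (P D) \<le> card (P B \<union> P C)"
    "card (P B \<inter> P C) + card (P B \<union> P C) = card (P B) + card (P C)"
proof -
  have fin: "finite (P \<sigma>)" for \<sigma>
    using finite_subset[OF assms(3,2)] by (simp add: P_def)
  show "card (P A) \<le> card (P B \<inter> P C)" "card (P D) \<le> card (P B \<union> P C)"
    using assms(1,3) fin by (auto intro!: card_mono simp: P_def plus_dominated_def)
  show "card (P B \<inter> P C) + card (P B \<union> P C) = card (P B) + card (P C)"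
    using card_Un_Int[OF fin fin] by simp
qed

lemma plus_prob_monotone:
  assumes "finite (pverts G)" "0 \<le> \<beta>"
    and le: "\<And>u. u \<in> pverts G \<Longrightarrow> \<sigma> u = 1 \<Longrightarrow> \<tau> u = 1"
  shows "plus_prob G \<beta> h \<sigma> v \<le> plus_prob G \<beta> h \<tau> v"
proof -
  have "card (plus_neighbours G \<sigma> v) \<le> card (plus_neighbours G \<tau> v)"
    using assms(1) le by (intro card_mono) (auto simp: plus_neighbours_def neighbours_def)
  then show ?thesis
    unfolding plus_prob_logistic using assms(2)
    by (intro logistic_mono mult_left_mono) auto
qed

text \<open>Monotonicity replaces the plus sets of \<open>A\<close> and \<open>D\<close> by the
  intersection and union of those of \<open>B\<close> and \<open>C\<close>; concavity then applies,
  the smallest field being nonnegative because \<open>h\<close> dominates the degree.\<close>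

lemma plus_prob_submodular:
  assumes "finite (pverts G)" "0 \<le> \<beta>" "real (degree G v) \<le> h"
    and dom: "plus_dominated (pverts G) A B C D"
  shows "plus_prob G \<beta> h A v + plus_prob G \<beta> h D v \<le> plus_prob G \<beta> h B v + plus_prob G \<beta> h C v"
proof -
  define g where "g n = logistic (2 * \<beta> * (2 * real n - real (degree G v) + h))" for n
  let ?P = "\<lambda>\<sigma>. plus_neighbours G \<sigma> v"
  have N: "neighbours G v \<subseteq> pverts G" "finite (neighbours G v)"
    using assms(1) by (auto simp: neighbours_def)
  note card = plus_dominated_card[OF dom assms(1) N(1), folded plus_neighbours_def]
  have mono: "g m \<le> g n" if "m \<le> n" for m n
    unfolding g_def using that assms(2) by (intro logistic_mono mult_left_mono) auto
  have "g (card (?P A)) + g (card (?P D)) \<le> g (card (?P B \<inter> ?P C)) + g (card (?P B \<union> ?P C))"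
    using mono card by (intro add_mono) auto
  also have "\<dots> \<le> g (card (?P B)) + g (card (?P C))"
  proof -
    have le: "card (?P B \<inter> ?P C) \<le> card (?P B)" "card (?P B \<inter> ?P C) \<le> card (?P C)"
      using N(2) by (auto intro!: card_mono simp: plus_neighbours_def)
    have "real (card (?P B \<inter> ?P C)) + real (card (?P B \<union> ?P C))
        = real (card (?P B)) + real (card (?P C))"
      using card(3) by linarith
    then have "2 * \<beta> * (2 * real (card (?P B \<inter> ?P C)) - real (degree G v) + h)
          + 2 * \<beta> * (2 * real (card (?P B \<union> ?P C)) - real (degree G v) + h)
        = 2 * \<beta> * (2 * real (card (?P B)) - real (degree G v) + h)
          + 2 * \<beta> * (2 * real (card (?P C)) - real (degree G v) + h)"
      by algebra
    then show ?thesis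
      unfolding g_def using le assms(2,3)
      by (intro logistic_concave mult_nonneg_nonneg mult_left_mono) auto
  qed
  finally show ?thesis
    unfolding plus_prob_logistic g_def .
qed

text \<open>Holding a vertex of \<open>S\<close> at \<open>+1\<close> amounts to resampling it with success probability 1, so that all
  cases of the update can be treated alike.\<close>

definition held_plus_prob ::
    "'a pair_pre_digraph \<Rightarrow> real \<Rightarrow> real \<Rightarrow> 'a set \<Rightarrow> 'a config \<Rightarrow> 'a \<Rightarrow> real" where
  "held_plus_prob G \<beta> h S \<sigma> v = (if v \<in> S then 1 else plus_prob G \<beta> h \<sigma> v)"

lemma corrupted_step_held:
  assumes "\<And>v. v \<in> S \<Longrightarrow> \<sigma> v = 1"
  shows "corrupted_step G \<beta> h S \<sigma> = bind_pmf (pmf_of_set (pverts G))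
    (\<lambda>v. map_pmf (\<lambda>b. \<sigma>(v := (if b then 1 else -1))) (bernoulli_pmf (held_plus_prob G \<beta> h S \<sigma> v)))"
proof -
  have "\<sigma>(v := 1) = \<sigma>" if "v \<in> S" for v
    using assms[OF that] by auto
  then show ?thesis
    unfolding corrupted_step_def resample_def held_plus_prob_def
    by (intro bind_pmf_cong) (auto simp: bernoulli_pmf_one)
qed

section \<open>Coupling of the four corrupted chains\<close>

text \<open>The held spins are recorded because \<open>corrupted_step_held\<close> assumes
  them.\<close>

definition coupling_invariant ::
    "'a set \<Rightarrow> 'a set \<Rightarrow> 'a set \<Rightarrow> 'a config \<Rightarrow> 'a config \<Rightarrow> 'a config \<Rightarrow> 'a config \<Rightarrow> bool" where
  "coupling_invariant V S T A B C D \<longleftrightarrow> plus_dominated V A B C D \<and>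
    (\<forall>v\<in>S \<inter> T. A v = 1) \<and> (\<forall>v\<in>S. B v = 1) \<and> (\<forall>v\<in>T. C v = 1) \<and> (\<forall>v\<in>S \<union> T. D v = 1)"

text \<open>All four chains update the same vertex, with coins coupled by
  \<open>rel_pmf4_bernoulli\<close>.\<close>

lemma corrupted_step_coupling:
  assumes fin: "finite (pverts G)" and ne: "pverts G \<noteq> {}" and \<beta>: "0 \<le> \<beta>"
    and h: "\<And>v. v \<in> pverts G \<Longrightarrow> real (degree G v) \<le> h"
    and inv: "coupling_invariant (pverts G) S T A B C D"
  shows "rel_pmf4 (coupling_invariant (pverts G) S T)
    (corrupted_step G \<beta> h (S \<inter> T) A) (corrupted_step G \<beta> h S B)
    (corrupted_step G \<beta> h T C) (corrupted_step G \<beta> h (S \<union> T) D)"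
proof -
  let ?q = "held_plus_prob G \<beta> h"
  have dom: "plus_dominated (pverts G) A B C D"
    and held: "\<And>v. v \<in> S \<inter> T \<Longrightarrow> A v = 1" "\<And>v. v \<in> S \<Longrightarrow> B v = 1"
      "\<And>v. v \<in> T \<Longrightarrow> C v = 1" "\<And>v. v \<in> S \<union> T \<Longrightarrow> D v = 1"
    using inv by (auto simp: coupling_invariant_def)
  have diag: "rel_pmf4 (\<lambda>v w x y. v \<in> pverts G \<and> w = v \<and> x = v \<and> y = v)
      (pmf_of_set (pverts G)) (pmf_of_set (pverts G)) (pmf_of_set (pverts G)) (pmf_of_set (pverts G))"
    by (rule rel_pmf4_diagonal) (use fin ne in auto)
  have coins: "rel_pmf4 (\<lambda>a b c d. (a \<longrightarrow> b \<and> c) \<and> (d \<longrightarrow> b \<or> c))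
      (bernoulli_pmf (?q (S \<inter> T) A v)) (bernoulli_pmf (?q S B v))
      (bernoulli_pmf (?q T C v)) (bernoulli_pmf (?q (S \<union> T) D v))" if v: "v \<in> pverts G" for v
  proof (rule rel_pmf4_bernoulli)
    have AB: "plus_prob G \<beta> h A v \<le> plus_prob G \<beta> h B v"
      and AC: "plus_prob G \<beta> h A v \<le> plus_prob G \<beta> h C v"
      using dom by (auto intro!: plus_prob_monotone[OF fin \<beta>] simp: plus_dominated_def)
    note bounds = plus_prob_bounds[of G \<beta> h]
    show "?q (S \<inter> T) A v \<le> ?q S B v" "?q (S \<inter> T) A v \<le> ?q T C v"
      using AB AC bounds by (auto simp: held_plus_prob_def)
    \<comment> \<open>For \<open>v\<close> in both sets all terms are 1; in exactly one, the ones
      cancel and \<open>AB\<close> or \<open>AC\<close> remains; in neither,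
      \<open>plus_prob_submodular\<close> applies.\<close>
    show "?q (S \<inter> T) A v + ?q (S \<union> T) D v \<le> ?q S B v + ?q T C v"
      using AB AC bounds plus_prob_submodular[OF fin \<beta> h[OF v] dom]
      by (auto simp: held_plus_prob_def)
  qed (auto simp: held_plus_prob_def plus_prob_bounds)
  have supp: "b \<in> set_pmf (bernoulli_pmf (?q U \<sigma> v)) \<Longrightarrow> v \<in> U \<Longrightarrow> b" for b U \<sigma> v
    by (simp add: held_plus_prob_def bernoulli_pmf_one)
  have update: "coupling_invariant (pverts G) S T
      (A(v := (if a then 1 else -1))) (B(v := (if b then 1 else -1)))
      (C(v := (if c then 1 else -1))) (D(v := (if d then 1 else -1)))"
    if "(a \<longrightarrow> b \<and> c) \<and> (d \<longrightarrow> b \<or> c)" "v \<in> S \<inter> T \<Longrightarrow> a" "v \<in> S \<Longrightarrow> b" "v \<in> T \<Longrightarrow> c"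
      "v \<in> S \<union> T \<Longrightarrow> d" for v a b c d
  proof -
    have "plus_dominated (pverts G) (A(v := (if a then 1 else -1))) (B(v := (if b then 1 else -1)))
      (C(v := (if c then 1 else -1))) (D(v := (if d then 1 else -1)))"
      unfolding plus_dominated_def
    proof
      fix u
      assume "u \<in> pverts G"
      with dom have u: "A u = 1 \<longrightarrow> B u = 1 \<and> C u = 1" "D u = 1 \<longrightarrow> B u = 1 \<or> C u = 1"
        by (simp_all add: plus_dominated_def)
      show "((A(v := (if a then 1 else -1))) u = 1 \<longrightarrow>
          (B(v := (if b then 1 else -1))) u = 1 \<and> (C(v := (if c then 1 else -1))) u = 1) \<and>
        ((D(v := (if d then 1 else -1))) u = 1 \<longrightarrow>
          (B(v := (if b then 1 else -1))) u = 1 \<or> (C(v := (if c then 1 else -1))) u = 1)"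
      proof (cases "u = v")
        case True
        then show ?thesis using that(1) by auto
      next
        case False
        then show ?thesis using u by simp
      qed
    qed
    then show ?thesis
      unfolding coupling_invariant_def using held that(2-) by (intro conjI ballI) (simp; blast)+
  qed
  have "rel_pmf4 (coupling_invariant (pverts G) S T)
      (map_pmf (\<lambda>b. A(v := (if b then 1 else -1))) (bernoulli_pmf (?q (S \<inter> T) A v)))
      (map_pmf (\<lambda>b. B(v := (if b then 1 else -1))) (bernoulli_pmf (?q S B v)))
      (map_pmf (\<lambda>b. C(v := (if b then 1 else -1))) (bernoulli_pmf (?q T C v)))
      (map_pmf (\<lambda>b. D(v := (if b then 1 else -1))) (bernoulli_pmf (?q (S \<union> T) D v)))"
    if "v \<in> pverts G" for v
    by (rule rel_pmf4_map[OF rel_pmf4_support[OF coins[OF that]]]) (blast intro!: update dest: supp)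
  then show ?thesis
    using held by (simp only: corrupted_step_held) (intro rel_pmf4_bind[OF diag], auto)
qed

lemma corrupted_glauber_coupling:
  assumes "finite (pverts G)" "pverts G \<noteq> {}" "0 \<le> \<beta>"
    and "\<And>v. v \<in> pverts G \<Longrightarrow> real (degree G v) \<le> h"
  shows "rel_pmf4 (coupling_invariant (pverts G) S T)
    (corrupted_glauber G \<beta> h (S \<inter> T) \<sigma>\<^sub>0 t) (corrupted_glauber G \<beta> h S \<sigma>\<^sub>0 t)
    (corrupted_glauber G \<beta> h T \<sigma>\<^sub>0 t) (corrupted_glauber G \<beta> h (S \<union> T) \<sigma>\<^sub>0 t)"
proof (induction t)
  case 0
  show ?case
    \<comment> \<open>The initial plus sets are that of \<open>\<sigma>\<^sub>0\<close> enlarged by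
      \<open>S \<inter> T\<close>, \<open>S\<close>, \<open>T\<close> and
      \<open>S \<union> T\<close>.\<close>
    unfolding corrupted_glauber.simps
    by (rule rel_pmf4_return) (auto simp: coupling_invariant_def plus_dominated_def corrupt_def)
next
  case (Suc t)
  then show ?case
    unfolding corrupted_glauber.simps
    by (rule rel_pmf4_bind) (rule corrupted_step_coupling[OF assms])
qed

theorem theorem6p8:
  fixes G :: "'a pair_pre_digraph" and \<beta> h :: real
    and \<sigma>\<^sub>0 :: "'a config" and t :: nat
  assumes "pair_graph G"
    and "\<beta> \<ge> 0"
    and "h \<ge> real (max_degree G)"
    and "\<sigma>\<^sub>0 \<in> configs (pverts G)"
  shows "submodular_on (pverts G)
    (\<lambda>S. measure_pmf.expectation (corrupted_glauber G \<beta> h S \<sigma>\<^sub>0 t)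
      (\<lambda>\<sigma>. real (card {v \<in> pverts G. \<sigma> v = 1})))"
\<comment> \<open>Uniform choice of a vertex requires a nonempty set; on the empty one
  \<open>S = T = {}\<close> and the inequality is trivial.\<close>
proof (cases "pverts G = {}")
  case True
  then show ?thesis
    by (simp add: submodular_on_def)
next
  case False
  interpret pair_graph G by fact
  have fin: "finite (pverts G)"
    by simp
  have deg: "real (degree G v) \<le> h" if "v \<in> pverts G" for v
  proof -
    have "degree G v \<le> max_degree G"
      unfolding max_degree_def using that fin by (intro Max_ge) auto
    then show ?thesis
      using assms(3) by linarith
  qed
  let ?f = "\<lambda>\<sigma> :: 'a config. real (card {v \<in> pverts G. \<sigma> v = 1})"
  have mono: "?f A + ?f D \<le> ?f B + ?f C" if "coupling_invariant (pverts G) S T A B C D" for S T A B C D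
    using plus_dominated_card[of "pverts G" A B C D "pverts G"] that fin
    by (auto simp: coupling_invariant_def)
  have bound: "norm (?f \<sigma>) \<le> real (card (pverts G))" for \<sigma>
    using fin by (auto intro!: card_mono)
  show ?thesis
    unfolding submodular_on_def
    using rel_pmf4_expectation_mono[where f = ?f,
        OF corrupted_glauber_coupling[OF fin False assms(2) deg] mono bound]
    by (simp add: add.commute)
qed

end
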